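(* Let $V$ be a finite non-empty set. For all $p,q\ge-1$ and all $u\in\Lambda_p$, $v\in\Lambda_q$, $$\partial(uv)=(\partial u)v+(-1)^{p+1}u\,\partial v.$$
   Context: Fix a field $\mathbb K$. For $p\ge0$, $\Lambda_p=\Lambda_p(V)$ is the $\mathbb K$-vector space with basis $e_{i_0\dots i_p}$ indexed by all sequences $i_0\dots i_p$ of $p+1$ vertices of $V$ (repetitions allowed); $\Lambda_{-1}=\mathbb K e$, where $e$ corresponds to the empty sequence; $\Lambda_{-2}=\{0\}$. The boundary operator $\partial:\Lambda_p\to\Lambda_{p-1}$ is linear with $\partial e_{i_0\dots i_p}=\sum_{q=0}^p(-1)^qe_{i_0\dots\widehat{i_q}\dots i_p}$ for $p\ge0$ (hat denotes omission; thus $\partial e_i=e$), and $\partial=0$ on $\Lambda_{-1}$. The join $uv\in\Lambda_{p+q+1}$ of $u\in\Lambda_p$ and $v\in\Lambda_q$ ($p,q\ge-1$) is the bilinear operation with $e_{i_0\dots i_p}e_{j_0\dots j_q}=e_{i_0\dots i_pj_0\dots j_q}$ (with $e$ neutral); if one of the factors lies in $\Lambda_{-2}$ the join is $0$. *)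

theory Defs
  imports Complex_Main "HOL-Library.Poly_Mapping"
begin

text \<open>
  The space of all chains is the space of finitely supported functions from sequences of vertices to
  the field; a sequence \<open>i\<^sub>0 \<dots> i\<^sub>p\<close> is a list of length \<open>p + 1\<close>, and \<open>e []\<close> is the element \<open>e\<close>.
\<close>

type_synonym ('v, 'k) chain = "'v list \<Rightarrow>\<^sub>0 'k"

definition e :: "'v list \<Rightarrow> ('v, 'k::field) chain" where
  "e xs = Poly_Mapping.single xs 1"

definition smul :: "'k::field \<Rightarrow> ('v, 'k) chain \<Rightarrow> ('v, 'k) chain"  (infixr "*\<^sub>c" 75) where
  "c *\<^sub>c u = Poly_Mapping.map ((*) c) u"

text \<open>The degree is an integer \<open>p \<ge> - 2\<close>. For \<open>p = - 2\<close> no list satisfies the length condition, so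
  the space is zero.\<close>

definition Lam :: "'v set \<Rightarrow> int \<Rightarrow> ('v, 'k::field) chain set"  ("\<Lambda>") where
  "\<Lambda> V p = {u. \<forall>xs \<in> Poly_Mapping.keys u. set xs \<subseteq> V \<and> int (length xs) = p + 1}"

definition omit :: "nat \<Rightarrow> 'v list \<Rightarrow> 'v list" where
  "omit q xs = take q xs @ drop (Suc q) xs"

text \<open>Linear extension from the basis. The empty sequence gives an empty inner sum, so the
  boundary vanishes in degree \<open>- 1\<close>.\<close>

definition boundary :: "('v, 'k::field) chain \<Rightarrow> ('v, 'k) chain"  ("\<partial>") where
  "\<partial> u = (\<Sum>xs \<in> Poly_Mapping.keys u. Poly_Mapping.lookup u xs *\<^sub>c
           (\<Sum>q < length xs. (- 1) ^ q *\<^sub>c e (omit q xs)))"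

text \<open>Bilinear extension of concatenation.\<close>

definition join :: "('v, 'k::field) chain \<Rightarrow> ('v, 'k) chain \<Rightarrow> ('v, 'k) chain"  (infixl "\<star>" 76) where
  "u \<star> v = (\<Sum>xs \<in> Poly_Mapping.keys u. \<Sum>ys \<in> Poly_Mapping.keys v.
           (Poly_Mapping.lookup u xs * Poly_Mapping.lookup v ys) *\<^sub>c e (xs @ ys))"

lemma lookup_e: "Poly_Mapping.lookup (e xs) ys = (if xs = ys then 1 else 0)"
  by (simp add: e_def lookup_single when_def)

lemma keys_e [simp]: "Poly_Mapping.keys (e xs) = {xs}"
  by (simp add: e_def)

lemma lookup_smul [simp]: "Poly_Mapping.lookup (c *\<^sub>c u) xs = c * Poly_Mapping.lookup u xs"
  by (simp add: smul_def Poly_Mapping.map.rep_eq when_def)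

lemma vector_space_smul: "vector_space smul"
  by unfold_locales (auto intro!: poly_mapping_eqI simp: lookup_add algebra_simps)

interpretation chain: vector_space smul
  by (rule vector_space_smul)

lemma expand_e: "u = (\<Sum>xs \<in> Poly_Mapping.keys u. Poly_Mapping.lookup u xs *\<^sub>c e xs)"
proof (rule poly_mapping_eqI)
  fix ys
  show "Poly_Mapping.lookup u ys =
    Poly_Mapping.lookup (\<Sum>xs \<in> Poly_Mapping.keys u. Poly_Mapping.lookup u xs *\<^sub>c e xs) ys"
    by (simp add: lookup_sum lookup_e sum.delta if_distrib[of "(*) _"] not_in_keys_iff_lookup_eq_zero cong: if_cong)
qed

lemma Lam_eq_span: "\<Lambda> V p = chain.span (e ` {xs. set xs \<subseteq> V \<and> int (length xs) = p + 1})"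
  (is "?L = chain.span (e ` ?B)")
proof
  show "?L \<subseteq> chain.span (e ` ?B)"
  proof
    fix u :: "('a, 'b) chain" assume u: "u \<in> ?L"
    have "(\<Sum>xs \<in> Poly_Mapping.keys u. Poly_Mapping.lookup u xs *\<^sub>c e xs) \<in> chain.span (e ` ?B)"
      using u by (intro chain.span_sum chain.span_scale chain.span_base) (auto simp: Lam_def)
    then show "u \<in> chain.span (e ` ?B)" using expand_e[of u] by simp
  qed
  have *: "u \<in> ?L \<longleftrightarrow> (\<forall>xs. xs \<notin> ?B \<longrightarrow> Poly_Mapping.lookup u xs = 0)" for u :: "('a, 'b) chain"
    unfolding Lam_def by (auto simp: in_keys_iff)
  show "chain.span (e ` ?B) \<subseteq> ?L"
  proof (rule chain.span_minimal)
    show "e ` ?B \<subseteq> ?L" by (auto simp: Lam_def)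
    show "chain.subspace ?L" unfolding chain.subspace_def by (auto simp: * lookup_add)
  qed
qed

lemma independent_e: "chain.independent (range e)"
proof
  assume "chain.dependent (range (e :: 'v list \<Rightarrow> ('v, 'k::field) chain))"
  then obtain a :: "('v, 'k) chain" where a: "a \<in> range e" "a \<in> chain.span (range e - {a})"
    unfolding chain.dependent_def by blast
  then obtain xs where xs: "a = e xs" by blast
  have "chain.span (range e - {a}) \<subseteq> {u. Poly_Mapping.lookup u xs = 0}"
    by (rule chain.span_minimal) (auto simp: xs chain.subspace_def lookup_add lookup_e)
  with a xs show False by (auto simp: lookup_e)
qed

lemma boundary_e: "\<partial> (e xs) = (\<Sum>q < length xs. (- 1) ^ q *\<^sub>c e (omit q xs))"
  by (simp add: boundary_def lookup_e)

lemma boundary_superset: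
  assumes "finite S" "Poly_Mapping.keys u \<subseteq> S"
  shows "\<partial> u = (\<Sum>xs \<in> S. Poly_Mapping.lookup u xs *\<^sub>c \<partial> (e xs))"
  unfolding boundary_def[of u] boundary_e
  by (rule sum.mono_neutral_left) (use assms in \<open>auto simp: in_keys_iff\<close>)

lemma linear_boundary: "Vector_Spaces.linear smul smul \<partial>"
proof unfold_locales
  fix u v :: "('v, 'k::field) chain" and c :: 'k
  let ?S = "Poly_Mapping.keys u \<union> Poly_Mapping.keys v"
  show "\<partial> (u + v) = \<partial> u + \<partial> v"
    by (subst (1 2 3) boundary_superset[of ?S])
       (use Poly_Mapping.keys_add[of u v] in
         \<open>auto simp: lookup_add chain.scale_left_distrib sum.distrib\<close>)
  show "\<partial> (c *\<^sub>c u) = c *\<^sub>c \<partial> u"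
    by (subst (1 2) boundary_superset[of "Poly_Mapping.keys u"])
       (auto simp: in_keys_iff chain.scale_sum_right)
qed

lemma join_e: "e xs \<star> e ys = e (xs @ ys)"
  by (simp add: join_def lookup_e)

lemma join_superset:
  assumes "finite S" "Poly_Mapping.keys u \<subseteq> S" "finite T" "Poly_Mapping.keys v \<subseteq> T"
  shows "u \<star> v = (\<Sum>xs \<in> S. \<Sum>ys \<in> T.
           (Poly_Mapping.lookup u xs * Poly_Mapping.lookup v ys) *\<^sub>c e (xs @ ys))"
proof -
  have "u \<star> v = (\<Sum>xs \<in> Poly_Mapping.keys u. \<Sum>ys \<in> T.
           (Poly_Mapping.lookup u xs * Poly_Mapping.lookup v ys) *\<^sub>c e (xs @ ys))"
    unfolding join_def
    by (intro sum.cong refl sum.mono_neutral_left) (use assms in \<open>auto simp: in_keys_iff\<close>)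
  also have "\<dots> = (\<Sum>xs \<in> S. \<Sum>ys \<in> T.
           (Poly_Mapping.lookup u xs * Poly_Mapping.lookup v ys) *\<^sub>c e (xs @ ys))"
    by (rule sum.mono_neutral_left) (use assms in \<open>auto simp: in_keys_iff\<close>)
  finally show ?thesis .
qed

lemma linear_join_left: "Vector_Spaces.linear smul smul (\<lambda>u. u \<star> v)"
proof unfold_locales
  fix u w :: "('v, 'k::field) chain" and c :: 'k and v :: "('v, 'k) chain"
  let ?S = "Poly_Mapping.keys u \<union> Poly_Mapping.keys w" and ?T = "Poly_Mapping.keys v"
  show "(u + w) \<star> v = u \<star> v + w \<star> v"
    by (subst (1 2 3) join_superset[of ?S _ ?T])
       (use Poly_Mapping.keys_add[of u w] in
         \<open>auto simp: lookup_add distrib_right chain.scale_left_distrib sum.distrib\<close>)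
  show "(c *\<^sub>c u) \<star> v = c *\<^sub>c (u \<star> v)"
    by (subst (1 2) join_superset[of "Poly_Mapping.keys u" _ ?T])
       (auto simp: in_keys_iff chain.scale_sum_right mult.assoc)
qed

lemma linear_join_right: "Vector_Spaces.linear smul smul (\<lambda>v. u \<star> v)"
proof unfold_locales
  fix v w :: "('v, 'k::field) chain" and c :: 'k and u :: "('v, 'k) chain"
  let ?S = "Poly_Mapping.keys v \<union> Poly_Mapping.keys w" and ?T = "Poly_Mapping.keys u"
  show "u \<star> (v + w) = u \<star> v + u \<star> w"
    by (subst (1 2 3) join_superset[of ?T _ ?S])
       (use Poly_Mapping.keys_add[of v w] in
         \<open>auto simp: lookup_add distrib_left chain.scale_left_distrib sum.distrib\<close>)
  show "u \<star> (c *\<^sub>c v) = c *\<^sub>c (u \<star> v)"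
    by (subst (1 2) join_superset[of ?T _ "Poly_Mapping.keys v"])
       (auto simp: in_keys_iff chain.scale_sum_right mult.left_commute)
qed

lemma subspace_Lam: "chain.subspace (\<Lambda> V p)"
  by (simp add: Lam_eq_span)

lemma e_in_Lam: "set xs \<subseteq> V \<Longrightarrow> int (length xs) = p + 1 \<Longrightarrow> e xs \<in> \<Lambda> V p"
  by (simp add: Lam_def)

lemma boundary_in_Lam:
  assumes "u \<in> \<Lambda> V p" shows "\<partial> u \<in> \<Lambda> V (p - 1)"
  unfolding boundary_def
proof (intro chain.subspace_sum[OF subspace_Lam] chain.subspace_scale[OF subspace_Lam] e_in_Lam)
  fix xs q assume xs: "xs \<in> Poly_Mapping.keys u" and q: "q \<in> {..<length xs}"
  show "set (omit q xs) \<subseteq> V"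
    using xs assms set_take_subset[of q xs] set_drop_subset[of "Suc q" xs]
    by (auto simp: Lam_def omit_def)
  show "int (length (omit q xs)) = p - 1 + 1"
    using xs q assms by (auto simp: Lam_def omit_def)
qed

lemma join_in_Lam:
  assumes "u \<in> \<Lambda> V p" "v \<in> \<Lambda> V q" shows "u \<star> v \<in> \<Lambda> V (p + q + 1)"
  unfolding join_def using assms
  by (intro chain.subspace_sum[OF subspace_Lam] chain.subspace_scale[OF subspace_Lam] e_in_Lam)
     (auto simp: Lam_def)

end

theory Submission
  imports Defs
begin

text \<open>
  The operators \<open>\<partial>\<close> and \<open>\<star>\<close> are extended linearly from sequences, so the identity is a statement
  about two sequences \<open>xs\<close> and \<open>ys\<close> (\<open>boundary_join_e\<close>). Deleting an entry of \<open>xs @ ys\<close> deletes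
  either an entry of \<open>xs\<close> or an entry of \<open>ys\<close>. The deletions of the first kind have the same
  position, hence the same sign, as in \<open>\<partial> (e xs)\<close>; for the second kind the position is shifted
  by \<open>length xs\<close>, which multiplies all signs of \<open>\<partial> (e ys)\<close> by \<open>(- 1) ^ length xs\<close>. On \<open>\<Lambda> V p\<close> all
  sequences have the same length \<open>p + 1\<close>, and this makes the sign a constant that passes through
  the linear extension in the first factor.
\<close>

lemma omit_append_left: "q < length xs \<Longrightarrow> omit q (xs @ ys) = omit q xs @ ys"
  by (simp add: omit_def)

lemma omit_append_right: "omit (length xs + q) (xs @ ys) = xs @ omit q ys"
  by (simp add: omit_def)

lemma sum_lessThan_add:
  fixes f :: "nat \<Rightarrow> 'a::comm_monoid_add"
  shows "(\<Sum>q < m + n. f q) = (\<Sum>q < m. f q) + (\<Sum>q < n. f (m + q))"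
  by (induction n) (simp_all add: add.assoc)

lemma boundary_join_e:
  fixes xs ys :: "'v list"
  shows "\<partial> (e xs \<star> e ys) =
    \<partial> (e xs) \<star> e ys + (- 1) ^ length xs *\<^sub>c (e xs \<star> \<partial> (e ys :: ('v, 'k::field) chain))"
proof -
  let ?y = "e ys :: ('v, 'k) chain"
  interpret l: Vector_Spaces.linear smul smul "\<lambda>u. u \<star> ?y" by (rule linear_join_left)
  interpret r: Vector_Spaces.linear smul smul "\<lambda>v :: ('v, 'k) chain. e xs \<star> v"
    by (rule linear_join_right)
  have "\<partial> (e xs \<star> ?y) =
      (\<Sum>q < length xs. (- 1) ^ q *\<^sub>c e (omit q xs @ ys)) +
      (\<Sum>q < length ys. (- 1) ^ (length xs + q) *\<^sub>c e (xs @ omit q ys))"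
    by (simp add: join_e boundary_e sum_lessThan_add omit_append_left omit_append_right)
  also have "(\<Sum>q < length xs. (- 1) ^ q *\<^sub>c e (omit q xs @ ys)) = \<partial> (e xs) \<star> ?y"
    by (simp add: boundary_e l.sum l.scale join_e)
  also have "(\<Sum>q < length ys. (- 1) ^ (length xs + q) *\<^sub>c e (xs @ omit q ys)) =
      (- 1) ^ length xs *\<^sub>c (e xs \<star> \<partial> ?y)"
    by (simp add: boundary_e r.sum r.scale join_e chain.scale_sum_right power_add)
  finally show ?thesis .
qed

text \<open>The second factor ranges over all chains, of mixed degrees too, since the sign depends only on
  the first.\<close>

lemma boundary_join_e_left:
  fixes v :: "('v, 'k::field) chain"
  shows "\<partial> (e xs \<star> v) = \<partial> (e xs) \<star> v + (- 1) ^ length xs *\<^sub>c (e xs \<star> \<partial> v)"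
proof -
  let ?x = "e xs :: ('v, 'k) chain"
  interpret b: Vector_Spaces.linear smul smul "\<partial> :: ('v, 'k) chain \<Rightarrow> _" by (rule linear_boundary)
  interpret r: Vector_Spaces.linear smul smul "\<lambda>v. ?x \<star> v" by (rule linear_join_right)
  interpret dr: Vector_Spaces.linear smul smul "\<lambda>v. \<partial> ?x \<star> v" by (rule linear_join_right)
  let ?c = "\<lambda>ys. Poly_Mapping.lookup v ys"
  have "\<partial> (?x \<star> (\<Sum>ys \<in> Poly_Mapping.keys v. ?c ys *\<^sub>c e ys)) =
      \<partial> ?x \<star> (\<Sum>ys \<in> Poly_Mapping.keys v. ?c ys *\<^sub>c e ys) +
      (- 1) ^ length xs *\<^sub>c (?x \<star> \<partial> (\<Sum>ys \<in> Poly_Mapping.keys v. ?c ys *\<^sub>c e ys))"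
    by (simp add: b.sum b.scale r.sum r.scale dr.sum dr.scale boundary_join_e
        chain.scale_right_distrib chain.scale_sum_right sum.distrib mult.commute)
  then show ?thesis by (simp flip: expand_e)
qed

theorem lemma2p6:
  fixes V :: "'v set" and p q :: int and u v :: "('v, 'k::field) chain"
  assumes "finite V" and "V \<noteq> {}"
    and "p \<ge> - 1" and "q \<ge> - 1"
    and "u \<in> \<Lambda> V p" and "v \<in> \<Lambda> V q"
  shows "\<partial> (u \<star> v) = (\<partial> u) \<star> v + (- 1) ^ nat (p + 1) *\<^sub>c (u \<star> \<partial> v)"
proof -
  interpret b: Vector_Spaces.linear smul smul "\<partial> :: ('v, 'k) chain \<Rightarrow> _" by (rule linear_boundary)
  interpret l: Vector_Spaces.linear smul smul "\<lambda>u. u \<star> v" by (rule linear_join_left)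
  interpret ld: Vector_Spaces.linear smul smul "\<lambda>u. u \<star> \<partial> v" by (rule linear_join_left)
  let ?c = "\<lambda>xs. Poly_Mapping.lookup u xs"
  have len: "length xs = nat (p + 1)" if "xs \<in> Poly_Mapping.keys u" for xs
    using that \<open>u \<in> \<Lambda> V p\<close> by (auto simp: Lam_def)
  have "\<partial> ((\<Sum>xs \<in> Poly_Mapping.keys u. ?c xs *\<^sub>c e xs) \<star> v) =
      \<partial> (\<Sum>xs \<in> Poly_Mapping.keys u. ?c xs *\<^sub>c e xs) \<star> v +
      (- 1) ^ nat (p + 1) *\<^sub>c ((\<Sum>xs \<in> Poly_Mapping.keys u. ?c xs *\<^sub>c e xs) \<star> \<partial> v)"
    by (simp add: b.sum b.scale l.sum l.scale ld.sum ld.scale boundary_join_e_left len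
        chain.scale_right_distrib chain.scale_sum_right sum.distrib mult.commute)
  then show ?thesis by (simp flip: expand_e)
qed

end
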